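(* Let $(M,J,g)$ be a metallic-like pseudo-Riemannian manifold with associated tensor field $J^{\ast}$, let $\nabla$ be a linear connection on $M$ and let $\nabla^{\ast}$ be its $g$-conjugate connection. Then: 1) $\nabla$ is a $J^{\ast}$-connection if and only if $\nabla^{\ast}$ is a $J$-connection. 2) $\nabla$ is a $J$-connection if and only if $\nabla^{\ast}$ is a $J^{\ast}$-connection.
   Context: A metallic structure on a smooth manifold $M$ is a $(1,1)$-tensor field $J$, which is a bundle isomorphism $TM\to TM$, such that $J^2=pJ+qI$ for some real numbers $p,q$ ($I$ the identity). A metallic-like pseudo-Riemannian manifold $(M,J,g)$ is a pseudo-Riemannian manifold $(M,g)$ with a metallic structure $J$ (not assumed $g$-symmetric) together with the $(1,1)$-tensor field $J^{\ast}$ satisfying $g(JX,Y)=g(X,J^{\ast}Y)$ for all vector fields $X,Y$ (so $(J^{\ast})^{\ast}=J$). For a $(1,1)$-tensor field $K$, a linear connection $\nabla$ is a $K$-connection if $\nabla K=0$. The $g$-conjugate connection $\nabla^{\ast}$ of $\nabla$ is defined by $Zg(X,Y)=g(\nabla_ZX,Y)+g(X,\nabla^{\ast}_ZY)$ for all vector fields $X,Y,Z$. *)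

theory Defs
  imports "HOL-Analysis.Analysis"
begin

text \<open>
  The manifold is the whole of a Hausdorff second countable type \<open>'a\<close>, equipped with an atlas of
  charts into a Euclidean space \<open>'b\<close>.  Tangent vectors at a point are derivations
  on the algebra of smooth functions, and all tensor fields are given pointwise.
\<close>

subsection \<open>Smooth manifolds\<close>

text \<open>\<open>C_k_on\<close> is meant for open sets only.\<close>

primrec C_k_on ::
    "nat \<Rightarrow> 'b::euclidean_space set \<Rightarrow> ('b \<Rightarrow> 'c::real_normed_vector) \<Rightarrow> bool" where
  "C_k_on 0 S f \<longleftrightarrow> continuous_on S f"
| "C_k_on (Suc k) S f \<longleftrightarrow>
     (\<forall>x\<in>S. f differentiable (at x)) \<and>
     (\<forall>v. C_k_on k S (\<lambda>x. frechet_derivative f (at x) v))"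

definition C_infinity_on ::
    "'b::euclidean_space set \<Rightarrow> ('b \<Rightarrow> 'c::real_normed_vector) \<Rightarrow> bool" where
  "C_infinity_on S f \<longleftrightarrow> (\<forall>k. C_k_on k S f)"

text \<open>A chart is a pair \<open>(U, \<phi>)\<close>; the values of \<open>\<phi>\<close> outside \<open>U\<close> are irrelevant.\<close>

type_synonym ('a, 'b) chart = "'a set \<times> ('a \<Rightarrow> 'b)"

definition is_chart :: "('a::topological_space, 'b::euclidean_space) chart \<Rightarrow> bool" where
  "is_chart c \<longleftrightarrow> (case c of (U, \<phi>) \<Rightarrow>
     open U \<and> open (\<phi> ` U) \<and> homeomorphism U (\<phi> ` U) \<phi> (inv_into U \<phi>))"

definition smooth_atlas :: "('a::topological_space, 'b::euclidean_space) chart set \<Rightarrow> bool" where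
  "smooth_atlas A \<longleftrightarrow>
     (\<forall>c\<in>A. is_chart c) \<and> (\<Union>c\<in>A. fst c) = UNIV \<and>
     (\<forall>(U, \<phi>)\<in>A. \<forall>(V, \<psi>)\<in>A. C_infinity_on (\<phi> ` (U \<inter> V)) (\<psi> \<circ> inv_into U \<phi>))"

definition smooth_functions ::
    "('a::topological_space, 'b::euclidean_space) chart set \<Rightarrow> ('a \<Rightarrow> real) set" where
  "smooth_functions A = {f. \<forall>(U, \<phi>)\<in>A. C_infinity_on (\<phi> ` U) (f \<circ> inv_into U \<phi>)}"


subsection \<open>Tangent vectors and vector fields\<close>

type_synonym 'a tvec = "('a \<Rightarrow> real) \<Rightarrow> real"
type_synonym 'a vfield = "'a \<Rightarrow> 'a tvec"

definition tv_zero :: "'a tvec" where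
  "tv_zero = (\<lambda>f. 0)"

definition tv_add :: "'a tvec \<Rightarrow> 'a tvec \<Rightarrow> 'a tvec" where
  "tv_add v w = (\<lambda>f. v f + w f)"

definition tv_scale :: "real \<Rightarrow> 'a tvec \<Rightarrow> 'a tvec" where
  "tv_scale c v = (\<lambda>f. c * v f)"

definition tv_diff :: "'a tvec \<Rightarrow> 'a tvec \<Rightarrow> 'a tvec" where
  "tv_diff v w = (\<lambda>f. v f - w f)"

text \<open>
  Being total functions, derivations are normalised to \<open>0\<close> on non-smooth arguments, so that
  equality of tangent vectors is equality of derivations.
\<close>

definition tangent_space ::
    "('a::topological_space, 'b::euclidean_space) chart set \<Rightarrow> 'a \<Rightarrow> 'a tvec set" where
  "tangent_space A x = {v.
     (\<forall>f. f \<notin> smooth_functions A \<longrightarrow> v f = 0) \<and>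
     (\<forall>f\<in>smooth_functions A. \<forall>h\<in>smooth_functions A. v (\<lambda>y. f y + h y) = v f + v h) \<and>
     (\<forall>c. \<forall>f\<in>smooth_functions A. v (\<lambda>y. c * f y) = c * v f) \<and>
     (\<forall>f\<in>smooth_functions A. \<forall>h\<in>smooth_functions A.
        v (\<lambda>y. f y * h y) = v f * h x + f x * v h)}"

definition vector_fields ::
    "('a::topological_space, 'b::euclidean_space) chart set \<Rightarrow> 'a vfield set" where
  "vector_fields A = {X.
     (\<forall>x. X x \<in> tangent_space A x) \<and>
     (\<forall>f\<in>smooth_functions A. (\<lambda>x. X x f) \<in> smooth_functions A)}"

definition vf_add :: "'a vfield \<Rightarrow> 'a vfield \<Rightarrow> 'a vfield" where
  "vf_add X Y = (\<lambda>x. tv_add (X x) (Y x))"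

definition vf_mult :: "('a \<Rightarrow> real) \<Rightarrow> 'a vfield \<Rightarrow> 'a vfield" where
  "vf_mult f X = (\<lambda>x. tv_scale (f x) (X x))"


subsection \<open>Tensor fields of type (1,1) and metallic structures\<close>

type_synonym 'a endo_field = "'a \<Rightarrow> 'a tvec \<Rightarrow> 'a tvec"

definition endo_apply :: "'a endo_field \<Rightarrow> 'a vfield \<Rightarrow> 'a vfield" where
  "endo_apply K X = (\<lambda>x. K x (X x))"

definition tensor_field_11 ::
    "('a::topological_space, 'b::euclidean_space) chart set \<Rightarrow> 'a endo_field \<Rightarrow> bool" where
  "tensor_field_11 A K \<longleftrightarrow>
     (\<forall>x. \<forall>v\<in>tangent_space A x. K x v \<in> tangent_space A x) \<and>
     (\<forall>x. \<forall>v\<in>tangent_space A x. \<forall>w\<in>tangent_space A x.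
        K x (tv_add v w) = tv_add (K x v) (K x w)) \<and>
     (\<forall>x c. \<forall>v\<in>tangent_space A x. K x (tv_scale c v) = tv_scale c (K x v)) \<and>
     (\<forall>X\<in>vector_fields A. endo_apply K X \<in> vector_fields A)"

definition bundle_isomorphism ::
    "('a::topological_space, 'b::euclidean_space) chart set \<Rightarrow> 'a endo_field \<Rightarrow> bool" where
  "bundle_isomorphism A K \<longleftrightarrow> tensor_field_11 A K \<and>
     (\<exists>L. tensor_field_11 A L \<and>
        (\<forall>x. \<forall>v\<in>tangent_space A x. L x (K x v) = v \<and> K x (L x v) = v))"

definition metallic_structure ::
    "('a::topological_space, 'b::euclidean_space) chart set \<Rightarrow> 'a endo_field \<Rightarrow> bool" where
  "metallic_structure A J \<longleftrightarrow> bundle_isomorphism A J \<and>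
     (\<exists>p q. \<forall>x. \<forall>v\<in>tangent_space A x.
        J x (J x v) = tv_add (tv_scale p (J x v)) (tv_scale q v))"


subsection \<open>Pseudo-Riemannian metrics\<close>

type_synonym 'a metric_field = "'a \<Rightarrow> 'a tvec \<Rightarrow> 'a tvec \<Rightarrow> real"

definition metric_apply :: "'a metric_field \<Rightarrow> 'a vfield \<Rightarrow> 'a vfield \<Rightarrow> 'a \<Rightarrow> real" where
  "metric_apply g X Y = (\<lambda>x. g x (X x) (Y x))"

text \<open>
  The index of \<open>g x\<close> is the largest dimension of a subspace of the tangent space on which
  \<open>g x\<close> is negative definite.  The condition on \<open>e\<close> below already forces the vectors
  \<open>e i\<close> with \<open>i < k\<close> to be linearly independent, so their span has dimension \<open>k\<close>.
\<close>

definition metric_index ::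
    "('a::topological_space, 'b::euclidean_space) chart set \<Rightarrow> 'a metric_field \<Rightarrow> 'a \<Rightarrow> nat" where
  "metric_index A g x = (GREATEST k. \<exists>e :: nat \<Rightarrow> 'a tvec.
     (\<forall>i<k. e i \<in> tangent_space A x) \<and>
     (\<forall>c. (\<exists>i<k. c i \<noteq> 0) \<longrightarrow>
        g x (\<lambda>f. \<Sum>i<k. c i * e i f) (\<lambda>f. \<Sum>i<k. c i * e i f) < 0))"

definition pseudo_riemannian_metric ::
    "('a::topological_space, 'b::euclidean_space) chart set \<Rightarrow> 'a metric_field \<Rightarrow> bool" where
  "pseudo_riemannian_metric A g \<longleftrightarrow>
     (\<forall>x. \<forall>u\<in>tangent_space A x. \<forall>v\<in>tangent_space A x. \<forall>w\<in>tangent_space A x.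
        g x (tv_add u v) w = g x u w + g x v w) \<and>
     (\<forall>x c. \<forall>v\<in>tangent_space A x. \<forall>w\<in>tangent_space A x.
        g x (tv_scale c v) w = c * g x v w) \<and>
     (\<forall>x. \<forall>v\<in>tangent_space A x. \<forall>w\<in>tangent_space A x. g x v w = g x w v) \<and>
     (\<forall>X\<in>vector_fields A. \<forall>Y\<in>vector_fields A. metric_apply g X Y \<in> smooth_functions A) \<and>
     (\<forall>x. \<forall>v\<in>tangent_space A x. (\<forall>w\<in>tangent_space A x. g x v w = 0) \<longrightarrow> v = tv_zero) \<and>
     (\<exists>\<nu>. \<forall>x. metric_index A g x = \<nu>)"

definition metallic_like_pseudo_riemannian ::
    "('a::{t2_space,second_countable_topology}, 'b::euclidean_space) chart set \<Rightarrow>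
     'a endo_field \<Rightarrow> 'a metric_field \<Rightarrow> 'a endo_field \<Rightarrow> bool" where
  "metallic_like_pseudo_riemannian A J g Jstar \<longleftrightarrow>
     smooth_atlas A \<and> pseudo_riemannian_metric A g \<and> metallic_structure A J \<and>
     tensor_field_11 A Jstar \<and>
     (\<forall>X\<in>vector_fields A. \<forall>Y\<in>vector_fields A.
        metric_apply g (endo_apply J X) Y = metric_apply g X (endo_apply Jstar Y))"


subsection \<open>Linear connections\<close>

text \<open>\<open>D Z X\<close> stands for the covariant derivative of \<open>X\<close> in the direction of \<open>Z\<close>.\<close>

type_synonym 'a connection = "'a vfield \<Rightarrow> 'a vfield \<Rightarrow> 'a vfield"

definition linear_connection ::
    "('a::topological_space, 'b::euclidean_space) chart set \<Rightarrow> 'a connection \<Rightarrow> bool" where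
  "linear_connection A D \<longleftrightarrow>
     (\<forall>Z\<in>vector_fields A. \<forall>X\<in>vector_fields A. D Z X \<in> vector_fields A) \<and>
     (\<forall>Z\<in>vector_fields A. \<forall>W\<in>vector_fields A. \<forall>X\<in>vector_fields A.
        D (vf_add Z W) X = vf_add (D Z X) (D W X)) \<and>
     (\<forall>f\<in>smooth_functions A. \<forall>Z\<in>vector_fields A. \<forall>X\<in>vector_fields A.
        D (vf_mult f Z) X = vf_mult f (D Z X)) \<and>
     (\<forall>Z\<in>vector_fields A. \<forall>X\<in>vector_fields A. \<forall>Y\<in>vector_fields A.
        D Z (vf_add X Y) = vf_add (D Z X) (D Z Y)) \<and>
     (\<forall>f\<in>smooth_functions A. \<forall>Z\<in>vector_fields A. \<forall>X\<in>vector_fields A.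
        D Z (vf_mult f X) = vf_add (vf_mult (\<lambda>x. Z x f) X) (vf_mult f (D Z X)))"

text \<open>The covariant derivative of a (1,1)-tensor field, evaluated on a vector field \<open>X\<close>.\<close>

definition endo_covariant_derivative ::
    "'a connection \<Rightarrow> 'a endo_field \<Rightarrow> 'a vfield \<Rightarrow> 'a vfield \<Rightarrow> 'a vfield" where
  "endo_covariant_derivative D K Z X =
     (\<lambda>x. tv_diff (D Z (endo_apply K X) x) (endo_apply K (D Z X) x))"

definition is_K_connection ::
    "('a::topological_space, 'b::euclidean_space) chart set \<Rightarrow> 'a endo_field \<Rightarrow>
     'a connection \<Rightarrow> bool" where
  "is_K_connection A K D \<longleftrightarrow>
     (\<forall>Z\<in>vector_fields A. \<forall>X\<in>vector_fields A. \<forall>x.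
        endo_covariant_derivative D K Z X x = tv_zero)"

text \<open>
  By nondegeneracy of \<open>g\<close> the identity below determines \<open>Dstar\<close> on vector fields, so this
  relation characterises the conjugate connection of \<open>D\<close>.
\<close>

definition conjugate_connection ::
    "('a::topological_space, 'b::euclidean_space) chart set \<Rightarrow> 'a metric_field \<Rightarrow>
     'a connection \<Rightarrow> 'a connection \<Rightarrow> bool" where
  "conjugate_connection A g D Dstar \<longleftrightarrow> linear_connection A Dstar \<and>
     (\<forall>X\<in>vector_fields A. \<forall>Y\<in>vector_fields A. \<forall>Z\<in>vector_fields A. \<forall>x.
        Z x (metric_apply g X Y) =
          metric_apply g (D Z X) Y x + metric_apply g X (Dstar Z Y) x)"

end

theory Submission
  imports Defs
begin

text \<open>
  Differentiating \<open>g(K X, Y) = g(X, K' Y)\<close> along \<open>Z\<close>, where \<open>K'\<close> is the \<open>g\<close>-adjoint of \<open>K\<close>,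
  and expanding both sides by the definition of the conjugate connection gives
    \<open>g((D\<^sub>Z K) X, Y) = g(X, (D\<^sup>*\<^sub>Z K') Y)\<close>,
  so \<open>D\<^sup>*\<^sub>Z K'\<close> is the adjoint of \<open>D\<^sub>Z K\<close>
  (\<open>endo_covariant_derivative_adjoint\<close>).  As \<open>g\<close> is nondegenerate, one of them vanishes exactly when
  the other does.  The two claims are the cases \<open>K = J\<^sup>*\<close> and \<open>K = J\<close>: by the symmetry of \<open>g\<close>,
  each of \<open>J\<close> and \<open>J\<^sup>*\<close> is the adjoint of the other.

  The hard point is hidden in the nondegeneracy.  The identity above is an identity between vector
  fields, while \<open>g\<close> is nondegenerate on each tangent space, so every tangent vector must be
  the value of a global vector field
  (\<open>tangent_vector_extends_to_vector_field\<close>).  For tangent vectors that are derivations this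
  has real content: one has to show that the coordinate derivatives span the tangent space, which is
  Hadamard's lemma, and to cut off a coordinate field by a bump function.  Only a bump function
  \<open>\<rho>\<close> that is positive at the given point is needed, because \<open>\<rho>\<^sup>2 f\<close> can be expanded globally
  in place of \<open>f\<close>, and the factor \<open>\<rho>(p)\<^sup>2\<close> divided out afterwards.
\<close>

section \<open>Functions of class \<open>C\<^sup>k\<close> on open sets\<close>

lemma C_k_on_subset: "C_k_on k S f \<Longrightarrow> T \<subseteq> S \<Longrightarrow> C_k_on k T f"
proof (induction k arbitrary: f)
  case 0
  then show ?case unfolding C_k_on.simps by (rule continuous_on_subset)
next
  case (Suc k)
  have "C_k_on k S (\<lambda>x. frechet_derivative f (at x) v)" for v
    using Suc.prems(1) unfolding C_k_on.simps by blast
  then have "C_k_on k T (\<lambda>x. frechet_derivative f (at x) v)" for v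
    using Suc.prems(2) by (rule Suc.IH)
  then show ?case
    using Suc.prems unfolding C_k_on.simps by blast
qed

lemma C_k_on_cong:
  assumes "open S" "\<And>x. x \<in> S \<Longrightarrow> f x = g x" "C_k_on k S f"
  shows "C_k_on k S g"
  using assms(2,3)
proof (induction k arbitrary: f g)
  case 0
  then show ?case
    by (auto intro: continuous_on_eq)
next
  case (Suc k)
  have eq: "frechet_derivative f (at x) = frechet_derivative g (at x)" if "x \<in> S" for x
    using Suc.prems that assms(1) by (intro frechet_derivative_transform_within_open[where X = S]) auto
  have "g differentiable (at x)" if "x \<in> S" for x
  proof -
    from Suc.prems(2) that obtain f' where "(f has_derivative f') (at x)"
      by (auto simp: differentiable_def)
    then have "(g has_derivative f') (at x)"
      using assms(1) that Suc.prems(1) by (rule has_derivative_transform_within_open)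
    then show ?thesis by (auto simp: differentiable_def)
  qed
  moreover have "C_k_on k S (\<lambda>x. frechet_derivative g (at x) v)" for v
    by (rule Suc.IH[of "\<lambda>x. frechet_derivative f (at x) v"]) (use Suc.prems(2) eq in auto)
  ultimately show ?case by simp
qed

lemma C_k_on_locally:
  assumes "open S" "\<And>x. x \<in> S \<Longrightarrow> \<exists>T. open T \<and> x \<in> T \<and> C_k_on k T f"
  shows "C_k_on k S f"
  using assms(2)
proof (induction k arbitrary: f)
  case 0
  have "isCont f x" if "x \<in> S" for x
  proof -
    from 0[OF that] obtain T where "open T" "x \<in> T" "continuous_on T f" by auto
    then show ?thesis by (simp add: continuous_on_eq_continuous_at)
  qed
  then show ?case by (simp add: continuous_at_imp_continuous_on)
next
  case (Suc k)
  have "f differentiable (at x)" if "x \<in> S" for x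
    using Suc.prems[OF that] by auto
  moreover have "C_k_on k S (\<lambda>x. frechet_derivative f (at x) v)" for v
  proof (rule Suc.IH)
    fix x assume "x \<in> S"
    from Suc.prems[OF this] obtain T where "open T" "x \<in> T" "C_k_on (Suc k) T f" by blast
    then show "\<exists>T. open T \<and> x \<in> T \<and> C_k_on k T (\<lambda>x. frechet_derivative f (at x) v)"
      by (intro exI[of _ T]) simp
  qed
  ultimately show ?case by simp
qed

lemma C_k_on_Suc_has_derivative:
  assumes "C_k_on (Suc k) S f" "x \<in> S"
  shows "(f has_derivative frechet_derivative f (at x)) (at x)"
  using assms unfolding C_k_on.simps by (metis frechet_derivative_works)

text \<open>
  This allows inductions on \<open>k\<close> to work with any formula for the derivative instead of
  the choice made by \<open>frechet_derivative\<close>.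
\<close>

lemma C_k_on_SucI:
  assumes "open S" "\<And>x. x \<in> S \<Longrightarrow> (f has_derivative f' x) (at x)" "\<And>v. C_k_on k S (\<lambda>x. f' x v)"
  shows "C_k_on (Suc k) S f"
proof -
  have "C_k_on k S (\<lambda>x. frechet_derivative f (at x) v)" for v
  proof (rule C_k_on_cong[OF assms(1) _ assms(3)])
    show "f' x v = frechet_derivative f (at x) v" if "x \<in> S" for x
      using frechet_derivative_at[OF assms(2)[OF that]] by simp
  qed
  moreover have "f differentiable (at x)" if "x \<in> S" for x
    using assms(2)[OF that] by (rule differentiableI)
  ultimately show ?thesis by simp
qed

lemma C_k_on_SucD: "C_k_on (Suc k) S f \<Longrightarrow> C_k_on k S f"
proof (induction k arbitrary: f)
  case 0
  have "isCont f x" if "x \<in> S" for x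
    using that 0 differentiable_imp_continuous_within[of f x UNIV] by simp
  then show ?case unfolding C_k_on.simps
    by (intro continuous_at_imp_continuous_on) simp
next
  case (Suc k)
  have "C_k_on (Suc k) S (\<lambda>x. frechet_derivative f (at x) v)" for v
    using Suc.prems unfolding C_k_on.simps(2)[of "Suc k"] by blast
  then have "C_k_on k S (\<lambda>x. frechet_derivative f (at x) v)" for v
    by (rule Suc.IH)
  with Suc.prems show ?case
    unfolding C_k_on.simps(2)[of "Suc k"] C_k_on.simps(2)[of k] by blast
qed

lemma C_k_on_imp_continuous_on: "C_k_on k S f \<Longrightarrow> continuous_on S f"
proof (induction k)
  case (Suc k)
  then show ?case by (metis C_k_on_SucD)
qed simp

lemma frechet_derivative_Basis_expansion:
  fixes f :: "'b::euclidean_space \<Rightarrow> real"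
  assumes "f differentiable (at x)"
  shows "frechet_derivative f (at x) w = (\<Sum>b\<in>Basis. (w \<bullet> b) * frechet_derivative f (at x) b)"
proof -
  interpret bounded_linear "frechet_derivative f (at x)"
    using assms by (simp add: frechet_derivative_works has_derivative_bounded_linear)
  show ?thesis
    by (subst euclidean_representation[of w, symmetric]) (simp only: sum scaleR real_scaleR_def)
qed

lemma convex_segment_mem:
  assumes "convex S" "p \<in> S" "y \<in> S" "t \<in> {0..1}"
  shows "p + t *\<^sub>R (y - p) \<in> S"
proof -
  have "p + t *\<^sub>R (y - p) = (1 - t) *\<^sub>R p + t *\<^sub>R y" by (simp add: algebra_simps)
  then show ?thesis using convexD_alt[OF assms(1-3)] assms(4) by simp
qed

lemma C_k_on_const: "open S \<Longrightarrow> C_k_on k S (\<lambda>x. c)"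
proof (induction k arbitrary: c)
  case (Suc k)
  then show ?case
    by (simp only: C_k_on.simps frechet_derivative_const differentiable_const) simp
qed simp

lemma C_k_on_bounded_linear:
  assumes "open S" "bounded_linear L" "C_k_on k S f"
  shows "C_k_on k S (\<lambda>x. L (f x))"
  using assms(3)
proof (induction k arbitrary: f)
  case 0
  then show ?case
    using bounded_linear.continuous_on[OF assms(2)] by simp
next
  case (Suc k)
  show ?case
  proof (rule C_k_on_SucI[OF assms(1)])
    show "((\<lambda>x. L (f x)) has_derivative (\<lambda>v. L (frechet_derivative f (at x) v))) (at x)" if "x \<in> S" for x
      using C_k_on_Suc_has_derivative[OF Suc.prems that] bounded_linear.has_derivative[OF assms(2)] by blast
    show "C_k_on k S (\<lambda>x. L (frechet_derivative f (at x) v))" for v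
      using Suc by simp
  qed
qed

lemma C_k_on_add:
  assumes "open S" "C_k_on k S f" "C_k_on k S g"
  shows "C_k_on k S (\<lambda>x. f x + g x)"
  using assms(2,3)
proof (induction k arbitrary: f g)
  case 0
  then show ?case by (simp add: continuous_on_add)
next
  case (Suc k)
  show ?case
  proof (rule C_k_on_SucI[OF assms(1)])
    show "((\<lambda>x. f x + g x) has_derivative
        (\<lambda>v. frechet_derivative f (at x) v + frechet_derivative g (at x) v)) (at x)" if "x \<in> S" for x
      using Suc.prems that by (intro has_derivative_add C_k_on_Suc_has_derivative)
    show "C_k_on k S (\<lambda>x. frechet_derivative f (at x) v + frechet_derivative g (at x) v)" for v
      using Suc by simp
  qed
qed

lemma C_k_on_sum:
  assumes "open S" "\<And>i. i \<in> I \<Longrightarrow> C_k_on k S (f i)"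
  shows "C_k_on k S (\<lambda>x. \<Sum>i\<in>I. f i x)"
  using assms(2)
  by (induction I rule: infinite_finite_induct) (auto intro!: C_k_on_const C_k_on_add assms(1))

lemma C_k_on_mult:
  fixes f g :: "'b::euclidean_space \<Rightarrow> real"
  assumes "open S" "C_k_on k S f" "C_k_on k S g"
  shows "C_k_on k S (\<lambda>x. f x * g x)"
  using assms(2,3)
proof (induction k arbitrary: f g)
  case 0
  then show ?case by (simp add: continuous_on_mult)
next
  case (Suc k)
  show ?case
  proof (rule C_k_on_SucI[OF assms(1)])
    show "((\<lambda>x. f x * g x) has_derivative
        (\<lambda>v. f x * frechet_derivative g (at x) v + frechet_derivative f (at x) v * g x)) (at x)" if "x \<in> S" for x
      using Suc.prems that by (intro has_derivative_mult C_k_on_Suc_has_derivative)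
    show "C_k_on k S (\<lambda>x. f x * frechet_derivative g (at x) v + frechet_derivative f (at x) v * g x)" for v
      using Suc.prems C_k_on_SucD[OF Suc.prems(1)] C_k_on_SucD[OF Suc.prems(2)]
      by (intro C_k_on_add Suc.IH assms(1)) auto
  qed
qed

text \<open>
  The directional derivatives in \<open>C_k_on\<close> have a fixed direction, but the chain rule produces
  the derivative of \<open>f\<close> in the direction \<open>g'(x) v\<close>, which varies with \<open>x\<close>.  Expanding that
  direction in the basis turns it into a sum of products, to which the induction hypothesis applies.
\<close>

lemma C_k_on_compose:
  fixes f :: "'c::euclidean_space \<Rightarrow> real" and g :: "'b::euclidean_space \<Rightarrow> 'c"
  assumes "open S" "open T" "g ` S \<subseteq> T" "C_k_on k T f" "C_k_on k S g"
  shows "C_k_on k S (\<lambda>x. f (g x))"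
  using assms(4,5)
proof (induction k arbitrary: f)
  case 0
  then show ?case
    using assms(3) by (auto intro: continuous_on_compose2)
next
  case (Suc k)
  let ?f' = "\<lambda>x. frechet_derivative f (at x)" and ?g' = "\<lambda>x. frechet_derivative g (at x)"
  show ?case
  proof (rule C_k_on_SucI[OF assms(1)])
    show "((\<lambda>x. f (g x)) has_derivative (\<lambda>v. \<Sum>b\<in>Basis. (?g' x v \<bullet> b) * ?f' (g x) b)) (at x)" if "x \<in> S" for x
    proof -
      have f: "(f has_derivative ?f' (g x)) (at (g x))"
        using Suc.prems(1) assms(3) that by (intro C_k_on_Suc_has_derivative) auto
      have "((\<lambda>x. f (g x)) has_derivative (\<lambda>v. ?f' (g x) (?g' x v))) (at x)"
        using has_derivative_compose[OF C_k_on_Suc_has_derivative[OF Suc.prems(2) that] f] .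
      moreover have "f differentiable (at (g x))"
        using f by (rule differentiableI)
      then have "(\<lambda>v. ?f' (g x) (?g' x v)) = (\<lambda>v. \<Sum>b\<in>Basis. (?g' x v \<bullet> b) * ?f' (g x) b)"
        by (intro ext frechet_derivative_Basis_expansion)
      ultimately show ?thesis by (rule has_derivative_eq_rhs)
    qed
    show "C_k_on k S (\<lambda>x. \<Sum>b\<in>Basis. (?g' x v \<bullet> b) * ?f' (g x) b)" for v
      using Suc.prems C_k_on_SucD[OF Suc.prems(2)]
      by (intro C_k_on_sum C_k_on_mult C_k_on_bounded_linear[OF assms(1) bounded_linear_inner_left] Suc.IH assms(1)) auto
  qed
qed

lemma C_k_on_ident: "open S \<Longrightarrow> C_k_on k S (\<lambda>x. x)"
  by (cases k) (auto intro!: C_k_on_const)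

section \<open>Hadamard's lemma\<close>

text \<open>
  Each derivative in \<open>y\<close> passes under the integral sign and produces a factor \<open>t\<close> by the chain
  rule; the power \<open>t ^ m\<close> is there to make the statement stable under this step.
\<close>

lemma C_k_on_parametric_integral:
  fixes h :: "'b::euclidean_space \<Rightarrow> real"
  assumes "open S" "convex S" "p \<in> S" "C_k_on k S h"
  shows "C_k_on k S (\<lambda>y. integral {0..1} (\<lambda>t. t ^ m * h (p + t *\<^sub>R (y - p))))"
  using assms(4)
proof (induction k arbitrary: h m)
  note line = convex_segment_mem[OF assms(2,3)]
  have line': "continuous_on (S \<times> {0..1}) (\<lambda>z. F (p + snd z *\<^sub>R (fst z - p)))"
    if "continuous_on S F" for F :: "'b \<Rightarrow> 'd::real_normed_vector"
    by (rule continuous_on_compose2[OF that]) (auto intro!: continuous_intros line)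
  {
    case (0 h m)
    then have "continuous_on S h" by simp
    then have "continuous_on (S \<times> cbox 0 1) (\<lambda>(y, t::real). t ^ m * h (p + t *\<^sub>R (y - p)))"
      unfolding split_beta cbox_interval by (intro continuous_on_mult continuous_intros line')
    from integral_continuous_on_param[OF this] show ?case by (simp add: cbox_interval)
  next
    case (Suc k h m)
    let ?h' = "\<lambda>x. frechet_derivative h (at x)"
    have lin: "bounded_linear (?h' x)" if "x \<in> S" for x
      using C_k_on_Suc_has_derivative[OF Suc.prems that] by (rule has_derivative_bounded_linear)
    have Ck: "C_k_on k S (\<lambda>x. ?h' x v)" for v
      using Suc.prems by simp
    have cont: "continuous_on S (\<lambda>x. ?h' x v)" for v
      using Ck by (rule C_k_on_imp_continuous_on)
    have "continuous_on S (\<lambda>x. blinfun_apply (Blinfun (?h' x)) v)" for v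
      using cont[of v] by (rule continuous_on_eq) (simp add: bounded_linear_Blinfun_apply lin)
    then have contB: "continuous_on S (\<lambda>x. Blinfun (?h' x))"
      by (intro continuous_on_blinfun_componentwise)
    have conth: "continuous_on S h"
      using Suc.prems by (rule C_k_on_imp_continuous_on)
    \<comment> \<open>The derivative of the integrand in \<open>y\<close>, as a bounded linear map so that its joint
      continuity in \<open>(y, t)\<close> can be stated.\<close>
    define B where "B y t = t ^ Suc m *\<^sub>R Blinfun (?h' (p + t *\<^sub>R (y - p)))" for y and t :: real
    have contBB: "continuous_on (S \<times> {0..1}) (\<lambda>(y, t). B y t)"
      unfolding B_def split_beta by (intro continuous_intros line' contB)
    have B_apply: "blinfun_apply (B y t) v = t ^ Suc m * ?h' (p + t *\<^sub>R (y - p)) v"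
      if "y \<in> S" "t \<in> {0..1}" for y t v
      using line[OF that] by (simp add: B_def blinfun.scaleR_left bounded_linear_Blinfun_apply lin)
    have contBy: "continuous_on {0..1} (B y)" if "y \<in> S" for y
    proof -
      have "continuous_on {0..1} (\<lambda>t. case (y, t) of (y, t) \<Rightarrow> B y t)"
        using that by (intro continuous_on_compose2[OF contBB]) (auto intro!: continuous_intros)
      then show ?thesis by simp
    qed
    have der: "((\<lambda>y. integral (cbox 0 1) (\<lambda>t. t ^ m * h (p + t *\<^sub>R (y - p)))) has_derivative
        blinfun_apply (integral (cbox 0 1) (B y))) (at y within S)" if y: "y \<in> S" for y
    proof (rule leibniz_rule[OF _ _ _ y assms(2)])
      fix y t assume yt: "y \<in> S" "t \<in> cbox (0::real) 1"
      then have "p + t *\<^sub>R (y - p) \<in> S" using line by simp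
      from C_k_on_Suc_has_derivative[OF Suc.prems this]
      have "((\<lambda>y. h (p + t *\<^sub>R (y - p))) has_derivative
          (\<lambda>v. ?h' (p + t *\<^sub>R (y - p)) (t *\<^sub>R v))) (at y within S)"
        by (rule has_derivative_compose[rotated]) (auto intro!: derivative_eq_intros)
      then have "((\<lambda>y. t ^ m * h (p + t *\<^sub>R (y - p))) has_derivative
          (\<lambda>v. t ^ m * ?h' (p + t *\<^sub>R (y - p)) (t *\<^sub>R v))) (at y within S)"
        by (rule has_derivative_mult_right)
      moreover have "t ^ m * ?h' (p + t *\<^sub>R (y - p)) (t *\<^sub>R v) = blinfun_apply (B y t) v" for v
        using yt line[of y t] linear_scale[OF bounded_linear.linear[OF lin]] by (subst B_apply) auto
      ultimately show "((\<lambda>y. t ^ m * h (p + t *\<^sub>R (y - p))) has_derivative blinfun_apply (B y t)) (at y within S)"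
        by simp
    next
      fix y assume "y \<in> S"
      then show "(\<lambda>t. t ^ m * h (p + t *\<^sub>R (y - p))) integrable_on cbox 0 1"
        unfolding cbox_interval
        by (intro integrable_continuous_interval continuous_on_mult continuous_on_compose2[OF conth])
          (auto intro!: continuous_intros line)
    next
      show "continuous_on (S \<times> cbox 0 1) (\<lambda>(y, t). B y t)"
        using contBB by (simp only: cbox_interval)
    qed
    have app: "blinfun_apply (integral (cbox 0 1) (B y)) v =
        integral {0..1} (\<lambda>t. t ^ Suc m * ?h' (p + t *\<^sub>R (y - p)) v)" if y: "y \<in> S" for y v
    proof -
      have "B y integrable_on cbox 0 1"
        using contBy[OF y] by (simp add: cbox_interval integrable_continuous_interval)
      then have "blinfun_apply (integral (cbox 0 1) (B y)) v = integral (cbox 0 1) (\<lambda>t. blinfun_apply (B y t) v)"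
        by (rule blinfun_apply_integral)
      also have "\<dots> = integral {0..1} (\<lambda>t. t ^ Suc m * ?h' (p + t *\<^sub>R (y - p)) v)"
        unfolding cbox_interval using y by (intro integral_cong B_apply)
      finally show ?thesis .
    qed
    show ?case
    proof (rule C_k_on_SucI[OF assms(1)])
      show "((\<lambda>y. integral {0..1} (\<lambda>t. t ^ m * h (p + t *\<^sub>R (y - p)))) has_derivative
          blinfun_apply (integral (cbox 0 1) (B y))) (at y)" if "y \<in> S" for y
        using der[OF that] at_within_open[OF that assms(1)] by (simp add: cbox_interval)
      show "C_k_on k S (\<lambda>y. blinfun_apply (integral (cbox 0 1) (B y)) v)" for v
        using C_k_on_cong[OF assms(1) app[symmetric] Suc.IH[OF Ck]] by simp
    qed
  }
qed

text \<open>
  Along the segment from \<open>p\<close> to \<open>y\<close>, the fundamental theorem of calculus writes \<open>f y - f p\<close> as the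
  integral of \<open>f'(p + t (y - p)) (y - p)\<close>.  Expanding \<open>y - p\<close> in the basis takes the coordinates out
  of the integral, and the remaining integrals are smooth in \<open>y\<close>.
\<close>

lemma Hadamard_lemma:
  fixes f :: "'b::euclidean_space \<Rightarrow> real"
  assumes "open S" "convex S" "p \<in> S" "C_infinity_on S f"
  obtains h where "\<And>b. C_infinity_on S (h b)"
    "\<And>y. y \<in> S \<Longrightarrow> f y = f p + (\<Sum>b\<in>Basis. ((y - p) \<bullet> b) * h b y)"
    "\<And>b. h b p = frechet_derivative f (at p) b"
proof
  let ?f' = "\<lambda>x. frechet_derivative f (at x)"
  let ?h = "\<lambda>b y. integral {0..1} (\<lambda>t. ?f' (p + t *\<^sub>R (y - p)) b)"
  have S: "C_k_on (Suc k) S f" for k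
    using assms(4) unfolding C_infinity_on_def by blast
  then have f': "C_k_on k S (\<lambda>x. ?f' x b)" for k b
    by simp
  show "C_infinity_on S (?h b)" for b
    unfolding C_infinity_on_def
    using C_k_on_parametric_integral[OF assms(1-3) f', of _ 0 b] by simp
  show "?h b p = ?f' p b" for b
    by simp
  fix y assume y: "y \<in> S"
  note line = convex_segment_mem[OF assms(2,3) y]
  have int: "(\<lambda>t. ?f' (p + t *\<^sub>R (y - p)) b) integrable_on {0..1}" for b
  proof -
    have "continuous_on S (\<lambda>x. ?f' x b)" using f'[of 0] by simp
    then have "continuous_on {0..1} (\<lambda>t. ?f' (p + t *\<^sub>R (y - p)) b)"
      by (rule continuous_on_compose2) (auto intro!: continuous_intros line)
    then show ?thesis
      by (rule integrable_continuous_interval)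
  qed
  have "((\<lambda>t. ?f' (p + t *\<^sub>R (y - p)) (y - p)) has_integral
      f (p + 1 *\<^sub>R (y - p)) - f (p + 0 *\<^sub>R (y - p))) {0..1}"
  proof (rule fundamental_theorem_of_calculus)
    fix t :: real assume t: "t \<in> {0..1}"
    have d: "(f has_derivative ?f' (p + t *\<^sub>R (y - p))) (at (p + t *\<^sub>R (y - p)))"
      using C_k_on_Suc_has_derivative[OF S line[OF t]] .
    have "((\<lambda>t. f (p + t *\<^sub>R (y - p))) has_derivative (\<lambda>s. ?f' (p + t *\<^sub>R (y - p)) (s *\<^sub>R (y - p)))) (at t within {0..1})"
      using d by (rule has_derivative_compose[rotated]) (auto intro!: derivative_eq_intros)
    moreover have "?f' (p + t *\<^sub>R (y - p)) (s *\<^sub>R (y - p)) = s *\<^sub>R ?f' (p + t *\<^sub>R (y - p)) (y - p)" for s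
      using linear_scale[OF bounded_linear.linear[OF has_derivative_bounded_linear[OF d]]] .
    ultimately show "((\<lambda>t. f (p + t *\<^sub>R (y - p))) has_vector_derivative ?f' (p + t *\<^sub>R (y - p)) (y - p)) (at t within {0..1})"
      by (simp add: has_vector_derivative_def)
  qed simp
  then have "f y - f p = integral {0..1} (\<lambda>t. ?f' (p + t *\<^sub>R (y - p)) (y - p))"
    by (simp add: integral_unique)
  also have "\<dots> = integral {0..1} (\<lambda>t. \<Sum>b\<in>Basis. ((y - p) \<bullet> b) * ?f' (p + t *\<^sub>R (y - p)) b)"
    using line S[of 0] by (intro integral_cong frechet_derivative_Basis_expansion) simp
  also have "\<dots> = (\<Sum>b\<in>Basis. ((y - p) \<bullet> b) * ?h b y)"
    using int by (subst integral_sum) (auto intro!: integrable_on_mult_right)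
  finally show "f y = f p + (\<Sum>b\<in>Basis. ((y - p) \<bullet> b) * ?h b y)" by simp
qed

section \<open>A smooth bump function\<close>

text \<open>
  The powers of \<open>1 / t\<close> are included because the derivative of \<open>exp (- 1 / t)\<close> produces them: the
  derivative of each function in this family is a linear combination of two others, so that all of
  them can be proved smooth together.
\<close>

definition flat_function :: "nat \<Rightarrow> real \<Rightarrow> real" where
  "flat_function n t = (if t > 0 then exp (- inverse t) * inverse t ^ n else 0)"

text \<open>
  With \<open>u = 1 / t\<close>, this is the bound \<open>u ^ (n + 2) / fact (n + 2) \<le> exp u\<close> by a single term of the
  exponential series.  A quadratic bound gives differentiability at \<open>0\<close> with derivative \<open>0\<close>.
\<close>

lemma flat_function_quadratic_bound:
  obtains C where "\<And>t. \<bar>flat_function n t\<bar> \<le> C * t\<^sup>2"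
proof
  fix t :: real
  show "\<bar>flat_function n t\<bar> \<le> fact (n + 2) * t\<^sup>2"
  proof (cases "t > 0")
    case True
    define u where "u = inverse t"
    have u: "u > 0" "t = inverse u" using True by (auto simp: u_def)
    have "(\<Sum>k<Suc (n + 2). u ^ k /\<^sub>R fact k) \<le> exp u"
      unfolding exp_def using u by (intro sum_le_suminf summable_exp_generic) auto
    moreover have "u ^ (n + 2) /\<^sub>R fact (n + 2) \<le> (\<Sum>k<Suc (n + 2). u ^ k /\<^sub>R fact k)"
      using u by (intro member_le_sum) auto
    ultimately have "u ^ (n + 2) /\<^sub>R fact (n + 2) \<le> exp u" by linarith
    then have "u ^ (n + 2) \<le> fact (n + 2) * exp u"
      by (simp add: divide_inverse_commute[symmetric] pos_divide_le_eq mult.commute del: fact_Suc)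
    then have "u ^ n * u\<^sup>2 / (exp u * u\<^sup>2) \<le> fact (n + 2) * exp u / (exp u * u\<^sup>2)"
      using u by (intro divide_right_mono) (auto simp: power2_eq_square mult_ac)
    moreover have "u ^ n * u\<^sup>2 / (exp u * u\<^sup>2) = exp (- u) * u ^ n"
      "fact (n + 2) * exp u / (exp u * u\<^sup>2) = fact (n + 2) * (inverse u)\<^sup>2"
      using u by (simp_all add: exp_minus divide_inverse power_inverse del: fact_Suc)
    ultimately have "exp (- u) * u ^ n \<le> fact (n + 2) * (inverse u)\<^sup>2" by metis
    then show ?thesis
      using True by (simp add: flat_function_def u_def del: fact_Suc)
  qed (simp add: flat_function_def)
qed

lemma flat_function_has_derivative:
  "(flat_function n has_real_derivative flat_function (n + 2) t - n * flat_function (n + 1) t) (at t)"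
proof -
  consider "t > 0" | "t < 0" | "t = 0" by linarith
  then show ?thesis
  proof cases
    case 1
    have "((\<lambda>t. exp (- inverse t) * inverse t ^ n) has_real_derivative
        flat_function (n + 2) t - n * flat_function (n + 1) t) (at t)"
    proof -
      have "((\<lambda>t. exp (- inverse t) * inverse t ^ n) has_real_derivative
          exp (- inverse t) * inverse t ^ 2 * inverse t ^ n
            + exp (- inverse t) * (n * inverse t ^ (n - 1) * (- (inverse t ^ 2)))) (at t)"
        using 1 by (auto intro!: derivative_eq_intros simp: power2_eq_square)
      moreover have "exp (- inverse t) * inverse t ^ 2 * inverse t ^ n
            + exp (- inverse t) * (n * inverse t ^ (n - 1) * (- (inverse t ^ 2)))
          = flat_function (n + 2) t - n * flat_function (n + 1) t"
        using 1 by (cases n) (auto simp: flat_function_def power2_eq_square algebra_simps)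
      ultimately show ?thesis by simp
    qed
    then show ?thesis
      by (rule has_field_derivative_transform_within_open[where S = "{0<..}"]) (use 1 in \<open>auto simp: flat_function_def\<close>)
  next
    case 2
    have "((\<lambda>t. 0) has_real_derivative flat_function (n + 2) t - n * flat_function (n + 1) t) (at t)"
      using 2 by (simp add: flat_function_def)
    then show ?thesis
      by (rule has_field_derivative_transform_within_open[where S = "{..<0}"]) (use 2 in \<open>auto simp: flat_function_def\<close>)
  next
    case 3
    obtain C where C: "\<bar>flat_function n t\<bar> \<le> C * t\<^sup>2" for t
      using flat_function_quadratic_bound by blast
    have "((\<lambda>h. flat_function n h / h) \<longlongrightarrow> 0) (at 0)"
    proof (rule tendsto_rabs_zero_cancel, rule tendsto_sandwich[OF _ _ tendsto_const])
      show "\<forall>\<^sub>F h in at 0. \<bar>flat_function n h / h\<bar> \<le> C * \<bar>h\<bar>"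
        unfolding eventually_at
      proof (intro exI[of _ 1] conjI ballI impI)
        fix h :: real assume "h \<noteq> 0 \<and> dist h 0 < 1"
        then show "\<bar>flat_function n h / h\<bar> \<le> C * \<bar>h\<bar>"
          using C[of h] by (simp add: abs_divide divide_le_eq power2_eq_square mult.assoc)
      qed simp
      show "((\<lambda>h. C * \<bar>h\<bar>) \<longlongrightarrow> 0) (at 0)"
        by (auto intro!: tendsto_eq_intros)
    qed auto
    then show ?thesis
      using 3 by (simp add: DERIV_def flat_function_def)
  qed
qed

lemma C_k_on_flat_function: "C_k_on k UNIV (flat_function n)"
proof (induction k arbitrary: n)
  case 0
  show ?case
    using flat_function_has_derivative by (auto intro!: continuous_at_imp_continuous_on DERIV_isCont)
next
  case (Suc k)
  show ?case
  proof (rule C_k_on_SucI)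
    show "(flat_function n has_derivative
        (\<lambda>v. (flat_function (n + 2) t + (- n) * flat_function (n + 1) t) * v)) (at t)" for t
      using flat_function_has_derivative[of n t] by (simp add: has_field_derivative_def)
    show "C_k_on k UNIV (\<lambda>t. (flat_function (n + 2) t + (- n) * flat_function (n + 1) t) * v)" for v
      by (intro C_k_on_mult C_k_on_add C_k_on_const Suc open_UNIV)
  qed simp
qed

text \<open>
  Take \<open>exp (- 1 / s)\<close> at \<open>s = r\<^sup>2 - dist p y ^ 2\<close>, the squared distance being a polynomial in \<open>y\<close>.
\<close>

lemma smooth_bump:
  fixes p :: "'b::euclidean_space"
  assumes "r > 0"
  obtains \<rho> :: "'b \<Rightarrow> real" where "C_infinity_on UNIV \<rho>" "\<rho> p > 0" "\<And>y. y \<notin> cball p r \<Longrightarrow> \<rho> y = 0"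
proof
  (* Written with sums, products and constants only, so that the closure rules for C_k_on apply. *)
  let ?\<rho> = "\<lambda>y. flat_function 0 (r\<^sup>2 + (- 1) * (\<Sum>b\<in>Basis. ((y + (- p)) \<bullet> b) * ((y + (- p)) \<bullet> b)))"
  show "C_infinity_on UNIV ?\<rho>"
    unfolding C_infinity_on_def
    by (intro allI C_k_on_compose[OF _ _ _ C_k_on_flat_function] C_k_on_mult C_k_on_add C_k_on_sum C_k_on_const C_k_on_ident
      C_k_on_bounded_linear[OF _ bounded_linear_inner_left] open_UNIV subset_UNIV)
  have eq: "(\<Sum>b\<in>Basis. ((y + (- p)) \<bullet> b) * ((y + (- p)) \<bullet> b)) = (dist p y)\<^sup>2" for y
    by (simp add: euclidean_inner[symmetric] dist_norm power2_norm_eq_inner norm_minus_commute[of p])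
  show "?\<rho> p > 0" using assms by (simp add: flat_function_def)
  show "?\<rho> y = 0" if "y \<notin> cball p r" for y
    using that assms power_mono[of r "dist p y" 2] unfolding eq by (simp add: flat_function_def not_less)
qed

section \<open>Smooth functions supported in a chart\<close>

lemma C_infinity_on_subset: "C_infinity_on S f \<Longrightarrow> T \<subseteq> S \<Longrightarrow> C_infinity_on T f"
  unfolding C_infinity_on_def using C_k_on_subset by blast

lemma C_infinity_on_mult:
  fixes f g :: "'b::euclidean_space \<Rightarrow> real"
  shows "open S \<Longrightarrow> C_infinity_on S f \<Longrightarrow> C_infinity_on S g \<Longrightarrow> C_infinity_on S (\<lambda>x. f x * g x)"
  unfolding C_infinity_on_def by (simp add: C_k_on_mult)

lemma C_infinity_on_frechet_derivative:
  "C_infinity_on S f \<Longrightarrow> C_infinity_on S (\<lambda>x. frechet_derivative f (at x) v)"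
  unfolding C_infinity_on_def by (metis C_k_on.simps(2))

lemma C_infinity_on_differentiable: "C_infinity_on S f \<Longrightarrow> x \<in> S \<Longrightarrow> f differentiable (at x)"
  unfolding C_infinity_on_def by (metis C_k_on.simps(2))

lemma smooth_atlas_chart:
  assumes "smooth_atlas A" "(U, \<phi>) \<in> A"
  shows "open U" "open (\<phi> ` U)" "homeomorphism U (\<phi> ` U) \<phi> (inv_into U \<phi>)"
  using assms unfolding smooth_atlas_def is_chart_def by auto

lemma smooth_functions_C_infinity_on:
  "f \<in> smooth_functions A \<Longrightarrow> (U, \<phi>) \<in> A \<Longrightarrow> C_infinity_on (\<phi> ` U) (f \<circ> inv_into U \<phi>)"
  unfolding smooth_functions_def by blast

lemma smooth_functions_const:
  assumes "smooth_atlas A"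
  shows "(\<lambda>y. c) \<in> smooth_functions A"
  unfolding smooth_functions_def C_infinity_on_def comp_def
  using smooth_atlas_chart(2)[OF assms] C_k_on_const by blast

lemma smooth_functions_add:
  assumes "smooth_atlas A" "f \<in> smooth_functions A" "h \<in> smooth_functions A"
  shows "(\<lambda>y. f y + h y) \<in> smooth_functions A"
  using assms(2,3) smooth_atlas_chart(2)[OF assms(1)] C_k_on_add
  unfolding smooth_functions_def C_infinity_on_def comp_def by blast

lemma smooth_functions_mult:
  assumes "smooth_atlas A" "f \<in> smooth_functions A" "h \<in> smooth_functions A"
  shows "(\<lambda>y. f y * h y) \<in> smooth_functions A"
  using assms(2,3) smooth_atlas_chart(2)[OF assms(1)] C_k_on_mult
  unfolding smooth_functions_def C_infinity_on_def comp_def by blast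

lemma smooth_functions_sum:
  assumes "smooth_atlas A" "\<And>i. i \<in> I \<Longrightarrow> f i \<in> smooth_functions A"
  shows "(\<lambda>y. \<Sum>i\<in>I. f i y) \<in> smooth_functions A"
  using assms(2)
  by (induction I rule: infinite_finite_induct)
    (auto intro: smooth_functions_const smooth_functions_add assms(1))

definition chart_extension :: "('a, 'b) chart \<Rightarrow> ('b \<Rightarrow> real) \<Rightarrow> 'a \<Rightarrow> real" where
  "chart_extension c h = (\<lambda>y. if y \<in> fst c then h (snd c y) else 0)"

text \<open>
  Around a point of the chart that \<open>\<phi>\<close> maps into \<open>B\<close>, the extension is \<open>h\<close> composed with a transition
  map.  Every other point lies outside the preimage of \<open>K\<close>, which is compact and hence closed because
  the manifold is Hausdorff, so the extension vanishes near it.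
  The set \<open>B\<close> may be smaller than the image of the chart; this is needed for the coefficients
  in Hadamard's lemma, which are smooth on a convex set only.
\<close>

lemma chart_extension_smooth:
  fixes A :: "('a::t2_space, 'b::euclidean_space) chart set"
  assumes A: "smooth_atlas A" "(U, \<phi>) \<in> A"
    and K: "compact K" "K \<subseteq> B" and B: "open B" "B \<subseteq> \<phi> ` U"
    and h: "C_infinity_on B h" "\<And>z. z \<notin> K \<Longrightarrow> h z = 0"
  shows "chart_extension (U, \<phi>) h \<in> smooth_functions A"
proof -
  let ?F = "chart_extension (U, \<phi>) h"
  note U = smooth_atlas_chart[OF A]
  have "C_k_on k (\<psi> ` V) (?F \<circ> inv_into V \<psi>)" if V\<psi>: "(V, \<psi>) \<in> A" for V \<psi> k
  proof (rule C_k_on_locally)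
    note V = smooth_atlas_chart[OF A(1) V\<psi>]
    show "open (\<psi> ` V)" by (rule V(2))
    have inv: "inv_into V \<psi> (\<psi> x) = x" if "x \<in> V" for x
      using V(3) that by (rule homeomorphism_apply1)
    have open_image: "open (\<psi> ` (V \<inter> W))" if "open W" for W
    proof -
      have "openin (top_of_set (\<psi> ` V)) (\<psi> ` (V \<inter> W))"
        using that by (intro homeomorphism_imp_open_map[OF V(3)]) (simp add: openin_open_Int)
      then show ?thesis using V(2) openin_open_trans by blast
    qed
    fix z assume "z \<in> \<psi> ` V"
    then obtain x where x: "x \<in> V" "z = \<psi> x" by blast
    show "\<exists>T. open T \<and> z \<in> T \<and> C_k_on k T (?F \<circ> inv_into V \<psi>)"
    proof (cases "x \<in> U \<inter> \<phi> -` B")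
      case True
      have W: "open (U \<inter> \<phi> -` B)"
        using U(1,3) B(1) by (intro continuous_open_preimage) (auto simp: homeomorphism_def)
      let ?T = "\<psi> ` (V \<inter> (U \<inter> \<phi> -` B))"
      have "C_infinity_on (\<psi> ` (V \<inter> U)) (\<phi> \<circ> inv_into V \<psi>)"
        using A(1) V\<psi> A(2) unfolding smooth_atlas_def by blast
      then have transition: "C_k_on k ?T (\<phi> \<circ> inv_into V \<psi>)"
        unfolding C_infinity_on_def using C_k_on_subset by (metis Int_mono image_mono inf_le1 subset_refl)
      have "C_k_on k ?T (\<lambda>y. h ((\<phi> \<circ> inv_into V \<psi>) y))"
      proof (rule C_k_on_compose[OF open_image[OF W] B(1) _ _ transition])
        show "(\<phi> \<circ> inv_into V \<psi>) ` ?T \<subseteq> B" using inv by auto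
        show "C_k_on k B h" using h(1) unfolding C_infinity_on_def by blast
      qed
      then have "C_k_on k ?T (?F \<circ> inv_into V \<psi>)"
        by (rule C_k_on_cong[OF open_image[OF W], rotated]) (auto simp: inv chart_extension_def)
      then show ?thesis
        using open_image[OF W] x True by blast
    next
      case False
      have "compact (inv_into U \<phi> ` K)"
        using K B(2) U(3) by (intro compact_continuous_image)
          (auto simp: homeomorphism_def intro: continuous_on_subset)
      then have W: "open (- (inv_into U \<phi> ` K))"
        by (intro open_Compl compact_imp_closed)
      let ?T = "\<psi> ` (V \<inter> - (inv_into U \<phi> ` K))"
      have zero: "?F y = 0" if "y \<notin> inv_into U \<phi> ` K" for y
      proof (cases "y \<in> U")
        case True
        then have "y = inv_into U \<phi> (\<phi> y)"
          using homeomorphism_apply1[OF U(3)] by simp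
        then have "\<phi> y \<notin> K" using that by blast
        then show ?thesis by (simp add: chart_extension_def h(2))
      qed (simp add: chart_extension_def)
      have "C_k_on k ?T (?F \<circ> inv_into V \<psi>)"
        by (rule C_k_on_cong[OF open_image[OF W] _ C_k_on_const[OF open_image[OF W], where c = 0]])
          (auto simp: inv zero)
      moreover have "x \<notin> inv_into U \<phi> ` K"
      proof
        assume "x \<in> inv_into U \<phi> ` K"
        then obtain u where u: "u \<in> K" "x = inv_into U \<phi> u" by blast
        then have "u \<in> B" "u \<in> \<phi> ` U" using K(2) B(2) by auto
        then show False
          using False inv_into_into[of u \<phi> U] f_inv_into_f[of u \<phi> U] u(2) by auto
      qed
      ultimately show ?thesis
        using open_image[OF W] x by blast
    qed
  qed
  then show ?thesis
    unfolding smooth_functions_def C_infinity_on_def by blast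
qed

section \<open>Extending tangent vectors to vector fields\<close>

lemma tangent_space_add:
  "v \<in> tangent_space A x \<Longrightarrow> f \<in> smooth_functions A \<Longrightarrow> h \<in> smooth_functions A
    \<Longrightarrow> v (\<lambda>y. f y + h y) = v f + v h"
  unfolding tangent_space_def by blast

lemma tangent_space_scale:
  "v \<in> tangent_space A x \<Longrightarrow> f \<in> smooth_functions A \<Longrightarrow> v (\<lambda>y. c * f y) = c * v f"
  unfolding tangent_space_def by blast

lemma tangent_space_mult:
  "v \<in> tangent_space A x \<Longrightarrow> f \<in> smooth_functions A \<Longrightarrow> h \<in> smooth_functions A
    \<Longrightarrow> v (\<lambda>y. f y * h y) = v f * h x + f x * v h"
  unfolding tangent_space_def by blast

lemma tangent_space_not_smooth:
  "v \<in> tangent_space A x \<Longrightarrow> f \<notin> smooth_functions A \<Longrightarrow> v f = 0"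
  unfolding tangent_space_def by blast

lemma tangent_space_sum:
  assumes "smooth_atlas A" "v \<in> tangent_space A x" "\<And>i. i \<in> I \<Longrightarrow> f i \<in> smooth_functions A"
  shows "v (\<lambda>y. \<Sum>i\<in>I. f i y) = (\<Sum>i\<in>I. v (f i))"
proof -
  have 0: "v (\<lambda>y. 0) = 0"
    using tangent_space_scale[OF assms(2) smooth_functions_const[OF assms(1)], of 0 0] by simp
  show ?thesis
    using assms(3)
  proof (induction I rule: infinite_finite_induct)
    case (insert i I)
    then have "v (\<lambda>y. f i y + (\<Sum>i\<in>I. f i y)) = v (f i) + v (\<lambda>y. \<Sum>i\<in>I. f i y)"
      by (intro tangent_space_add[OF assms(2)] smooth_functions_sum assms(1)) auto
    with insert show ?case by simp
  qed (simp_all add: 0)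
qed

lemma tangent_space_tv_diff:
  assumes "u \<in> tangent_space A x" "v \<in> tangent_space A x"
  shows "tv_diff u v \<in> tangent_space A x"
  using assms unfolding tangent_space_def tv_diff_def by (simp add: algebra_simps)

text \<open>
  The coordinate field in the constant direction \<open>w\<close>, cut off by \<open>\<rho>\<close>.  It is \<open>0\<close> on non-smooth
  functions by the normalisation of tangent vectors.
\<close>

definition chart_field ::
    "('a::topological_space, 'b::euclidean_space) chart set \<Rightarrow> ('a, 'b) chart \<Rightarrow> ('b \<Rightarrow> real) \<Rightarrow> 'b \<Rightarrow> 'a vfield" where
  "chart_field A c \<rho> w = (\<lambda>y f. if y \<in> fst c \<and> f \<in> smooth_functions A
     then \<rho> (snd c y) * frechet_derivative (f \<circ> inv_into (fst c) (snd c)) (at (snd c y)) w else 0)"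

lemma chart_field_vector_field:
  fixes A :: "('a::t2_space, 'b::euclidean_space) chart set"
  assumes A: "smooth_atlas A" "(U, \<phi>) \<in> A"
    and K: "compact K" "K \<subseteq> \<phi> ` U"
    and \<rho>: "C_infinity_on (\<phi> ` U) \<rho>" "\<And>z. z \<notin> K \<Longrightarrow> \<rho> z = 0"
  shows "chart_field A (U, \<phi>) \<rho> w \<in> vector_fields A"
proof -
  let ?X = "chart_field A (U, \<phi>) \<rho> w"
  let ?d = "\<lambda>f y. frechet_derivative (f \<circ> inv_into U \<phi>) (at (\<phi> y))"
  note U = smooth_atlas_chart[OF A]
  have "?X y \<in> tangent_space A y" for y
  proof (cases "y \<in> U")
    case True
    have inv: "inv_into U \<phi> (\<phi> y) = y"
      using U(3) True by (rule homeomorphism_apply1)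
    have der: "((f \<circ> inv_into U \<phi>) has_derivative ?d f y) (at (\<phi> y))" if "f \<in> smooth_functions A" for f
      using C_infinity_on_differentiable[OF smooth_functions_C_infinity_on[OF that A(2)]] True
      by (simp add: frechet_derivative_works)
    have add: "?d (\<lambda>y. f y + h y) y w = ?d f y w + ?d h y w"
      if "f \<in> smooth_functions A" "h \<in> smooth_functions A" for f h
      using frechet_derivative_at[OF has_derivative_add[OF der[OF that(1)] der[OF that(2)]]]
      by (simp add: comp_def fun_eq_iff)
    have scale: "?d (\<lambda>y. c * f y) y w = c * ?d f y w" if "f \<in> smooth_functions A" for f c
      using frechet_derivative_at[OF has_derivative_mult_right[OF der[OF that], of c]]
      by (simp add: comp_def fun_eq_iff)
    have mult: "?d (\<lambda>y. f y * h y) y w = ?d f y w * h y + f y * ?d h y w"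
      if "f \<in> smooth_functions A" "h \<in> smooth_functions A" for f h
      using frechet_derivative_at[OF has_derivative_mult[OF der[OF that(1)] der[OF that(2)]], THEN fun_cong, of w]
      by (simp add: comp_def inv)
    show ?thesis
      unfolding tangent_space_def chart_field_def
      using True add scale mult smooth_functions_add[OF A(1)] smooth_functions_mult[OF A(1)]
        smooth_functions_mult[OF A(1) smooth_functions_const[OF A(1)]]
      by (simp add: algebra_simps)
  qed (simp add: tangent_space_def chart_field_def)
  moreover have "(\<lambda>y. ?X y f) \<in> smooth_functions A" if f: "f \<in> smooth_functions A" for f
  proof -
    have "chart_extension (U, \<phi>) (\<lambda>z. \<rho> z * frechet_derivative (f \<circ> inv_into U \<phi>) (at z) w) \<in> smooth_functions A"
      by (rule chart_extension_smooth[OF A K U(2)])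
        (auto intro!: C_infinity_on_mult U(2) \<rho> C_infinity_on_frechet_derivative
          smooth_functions_C_infinity_on[OF f A(2)])
    also have "chart_extension (U, \<phi>) (\<lambda>z. \<rho> z * frechet_derivative (f \<circ> inv_into U \<phi>) (at z) w) = (\<lambda>y. ?X y f)"
      using f by (auto simp: chart_extension_def chart_field_def)
    finally show ?thesis .
  qed
  ultimately show ?thesis
    unfolding vector_fields_def by blast
qed

text \<open>
  Let \<open>p\<close> be the image of \<open>x\<close> in a chart and \<open>\<rho>\<close> a bump function at \<open>p\<close>.  In this chart, Hadamard's
  lemma gives \<open>\<rho>\<^sup>2 f = f(p) \<rho>\<^sup>2 + (\<Sum>b. \<xi>\<^sub>b (\<rho> h\<^sub>b))\<close> with \<open>\<xi>\<^sub>b(z) = \<rho>(z) ((z - p) \<bullet> b)\<close>, and after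
  extension by zero all the factors are smooth on the whole manifold.  Since \<open>\<xi>\<^sub>b\<close> vanishes at \<open>p\<close>, the
  Leibniz rule yields \<open>\<rho>(p)\<^sup>2 v(f) = (\<Sum>b. v(\<xi>\<^sub>b) \<rho>(p) \<partial>\<^sub>b f(p))\<close>.  Thus \<open>v\<close> is
  a coordinate derivative in some direction, and the corresponding cut-off coordinate field extends it.
\<close>

lemma tangent_vector_extends_to_vector_field:
  fixes A :: "('a::t2_space, 'b::euclidean_space) chart set"
  assumes A: "smooth_atlas A" and v: "v \<in> tangent_space A x"
  obtains X where "X \<in> vector_fields A" "X x = v"
proof -
  from A obtain U \<phi> where c: "(U, \<phi>) \<in> A" "x \<in> U"
    unfolding smooth_atlas_def by (metis (no_types, lifting) UNIV_I UN_E prod.collapse)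
  note U = smooth_atlas_chart[OF A c(1)]
  define p where "p = \<phi> x"
  have inv: "inv_into U \<phi> (\<phi> y) = y" if "y \<in> U" for y
    using U(3) that by (rule homeomorphism_apply1)
  from U(2) c(2) obtain e where e: "e > 0" "cball p e \<subseteq> \<phi> ` U"
    unfolding open_contains_cball p_def by blast
  define B where "B = ball p e"
  define K where "K = cball p (e / 2)"
  have B: "open B" "convex B" "p \<in> B" "B \<subseteq> \<phi> ` U" and K: "compact K" "K \<subseteq> B"
    using e by (auto simp: B_def K_def)
  obtain \<rho> :: "'b \<Rightarrow> real" where \<rho>: "C_infinity_on UNIV \<rho>" "\<rho> p > 0" "\<And>z. z \<notin> K \<Longrightarrow> \<rho> z = 0"
    using smooth_bump[of "e / 2" p] e(1) unfolding K_def by auto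
  have \<rho>B: "C_infinity_on B \<rho>"
    using \<rho>(1) by (rule C_infinity_on_subset) simp
  let ?ext = "\<lambda>h. chart_extension (U, \<phi>) (\<lambda>z. \<rho> z * h z)"
  have ext: "?ext h \<in> smooth_functions A" if "C_infinity_on B h" for h
    by (rule chart_extension_smooth[OF A c(1) K B(1,4)])
      (auto intro!: C_infinity_on_mult B(1) \<rho>B that simp: \<rho>(3))
  have ext_x: "?ext h x = \<rho> p * h p" for h
    using c(2) by (simp add: chart_extension_def p_def)
  define \<xi> where "\<xi> b = ?ext (\<lambda>z. (z - p) \<bullet> b)" for b
  have \<xi>: "\<xi> b \<in> smooth_functions A" for b
    unfolding \<xi>_def
  proof (rule ext)
    have "C_k_on k B (\<lambda>z. (z + (- p)) \<bullet> b)" for k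
      by (intro C_k_on_bounded_linear[OF _ bounded_linear_inner_left] C_k_on_add C_k_on_const C_k_on_ident B(1))
    then show "C_infinity_on B (\<lambda>z. (z - p) \<bullet> b)"
      by (simp add: C_infinity_on_def)
  qed
  \<comment> \<open>The square compensates for the factor \<open>\<rho> p\<close> in the field as well as for the one in \<open>\<xi>\<close>.\<close>
  define w where "w = (\<Sum>b\<in>Basis. (v (\<xi> b) / (\<rho> p)\<^sup>2) *\<^sub>R b)"
  have "chart_field A (U, \<phi>) \<rho> w x f = v f" for f
  proof (cases "f \<in> smooth_functions A")
    case f: True
    let ?f = "f \<circ> inv_into U \<phi>"
    let ?\<rho>2 = "?ext \<rho>"
    have fU: "C_infinity_on (\<phi> ` U) ?f"
      using f c(1) by (rule smooth_functions_C_infinity_on)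
    then obtain h where h: "\<And>b. C_infinity_on B (h b)"
      "\<And>z. z \<in> B \<Longrightarrow> ?f z = ?f p + (\<Sum>b\<in>Basis. ((z - p) \<bullet> b) * h b z)"
      "\<And>b. h b p = frechet_derivative ?f (at p) b"
      using Hadamard_lemma[OF B(1-3) C_infinity_on_subset[OF _ B(4)]] by blast
    have split: "?\<rho>2 y * f y = f x * ?\<rho>2 y + (\<Sum>b\<in>Basis. \<xi> b y * ?ext (h b) y)" for y
    proof (cases "y \<in> U \<and> \<phi> y \<in> B")
      case True
      then have "f y = f x + (\<Sum>b\<in>Basis. ((\<phi> y - p) \<bullet> b) * h b (\<phi> y))"
        using h(2)[of "\<phi> y"] inv c(2) by (simp add: p_def)
      then have "?\<rho>2 y * f y = ?\<rho>2 y * (f x + (\<Sum>b\<in>Basis. ((\<phi> y - p) \<bullet> b) * h b (\<phi> y)))"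
        by metis
      then show ?thesis
        using True by (simp add: \<xi>_def chart_extension_def distrib_left sum_distrib_left mult_ac)
    next
      case False
      then have "y \<notin> U \<or> \<rho> (\<phi> y) = 0"
        using K(2) \<rho>(3) by blast
      then show ?thesis
        by (auto simp: \<xi>_def chart_extension_def)
    qed
    have "v ?\<rho>2 * f x + (\<rho> p)\<^sup>2 * v f = v (\<lambda>y. ?\<rho>2 y * f y)"
      using tangent_space_mult[OF v ext[OF \<rho>B] f] by (simp add: ext_x power2_eq_square)
    also have "\<dots> = v (\<lambda>y. f x * ?\<rho>2 y + (\<Sum>b\<in>Basis. \<xi> b y * ?ext (h b) y))"
      by (simp only: split)
    also have "\<dots> = v (\<lambda>y. f x * ?\<rho>2 y) + v (\<lambda>y. \<Sum>b\<in>Basis. \<xi> b y * ?ext (h b) y)"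
      by (intro tangent_space_add[OF v] smooth_functions_sum smooth_functions_mult smooth_functions_const A \<xi> ext \<rho>B h(1))
    also have "v (\<lambda>y. f x * ?\<rho>2 y) = f x * v ?\<rho>2"
      by (intro tangent_space_scale[OF v] ext \<rho>B)
    also have "v (\<lambda>y. \<Sum>b\<in>Basis. \<xi> b y * ?ext (h b) y) = (\<Sum>b\<in>Basis. v (\<lambda>y. \<xi> b y * ?ext (h b) y))"
      by (intro tangent_space_sum[OF A v] smooth_functions_mult A \<xi> ext h(1))
    also have "\<dots> = (\<Sum>b\<in>Basis. v (\<xi> b) * (\<rho> p * frechet_derivative ?f (at p) b))"
    proof (rule sum.cong[OF refl])
      fix b
      have "\<xi> b x = 0" unfolding \<xi>_def ext_x by simp
      then show "v (\<lambda>y. \<xi> b y * ?ext (h b) y) = v (\<xi> b) * (\<rho> p * frechet_derivative ?f (at p) b)"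
        using tangent_space_mult[OF v \<xi> ext[OF h(1)]] by (simp add: ext_x h(3))
    qed
    finally have "(\<rho> p)\<^sup>2 * v f = (\<Sum>b\<in>Basis. v (\<xi> b) * (\<rho> p * frechet_derivative ?f (at p) b))"
      by simp
    moreover have "chart_field A (U, \<phi>) \<rho> w x f = \<rho> p * frechet_derivative ?f (at p) w"
      using f c(2) by (simp add: chart_field_def p_def)
    moreover have "frechet_derivative ?f (at p) w = (\<Sum>b\<in>Basis. (w \<bullet> b) * frechet_derivative ?f (at p) b)"
      using C_infinity_on_differentiable[OF fU] B(3,4) by (intro frechet_derivative_Basis_expansion) blast
    moreover have "w \<bullet> b = v (\<xi> b) / (\<rho> p)\<^sup>2" if "b \<in> Basis" for b
      using that by (simp add: w_def inner_sum_left_Basis)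
    ultimately have "(\<rho> p)\<^sup>2 * chart_field A (U, \<phi>) \<rho> w x f = (\<rho> p)\<^sup>2 * v f"
      using \<rho>(2) by (simp add: sum_distrib_left mult_ac)
    then show ?thesis
      using \<rho>(2) by simp
  next
    case False
    then show ?thesis
      using tangent_space_not_smooth[OF v] by (simp add: chart_field_def)
  qed
  moreover have "chart_field A (U, \<phi>) \<rho> w \<in> vector_fields A"
    using K B(4) \<rho>(3) by (intro chart_field_vector_field[OF A c(1) K(1)])
      (auto intro: C_infinity_on_subset[OF \<rho>(1)])
  ultimately show ?thesis
    using that by blast
qed

section \<open>Conjugate connections and adjoint tensor fields\<close>

lemma metric_nondegenerate_on_vector_fields:
  fixes A :: "('a::t2_space, 'b::euclidean_space) chart set"
  assumes "smooth_atlas A" "pseudo_riemannian_metric A g" "u \<in> tangent_space A x"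
    and "\<And>X. X \<in> vector_fields A \<Longrightarrow> g x u (X x) = 0"
  shows "u = tv_zero"
proof -
  have "g x u v = 0" if "v \<in> tangent_space A x" for v
    using tangent_vector_extends_to_vector_field[OF assms(1) that] assms(4) by metis
  then show ?thesis
    using assms(2,3) unfolding pseudo_riemannian_metric_def by blast
qed

lemma metric_symmetric:
  assumes "pseudo_riemannian_metric A g" "u \<in> tangent_space A x" "v \<in> tangent_space A x"
  shows "g x u v = g x v u"
  using assms unfolding pseudo_riemannian_metric_def by blast

lemma metric_tv_diff_left:
  assumes g: "pseudo_riemannian_metric A g"
    and uvw: "u \<in> tangent_space A x" "v \<in> tangent_space A x" "w \<in> tangent_space A x"
  shows "g x (tv_diff u v) w = g x u w - g x v w"
proof -
  have "tv_diff u v \<in> tangent_space A x"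
    using uvw by (intro tangent_space_tv_diff)
  moreover have "tv_add (tv_diff u v) v = u"
    by (simp add: tv_add_def tv_diff_def)
  moreover have "g x (tv_add a v) w = g x a w + g x v w" if "a \<in> tangent_space A x" for a
    using g that uvw unfolding pseudo_riemannian_metric_def by blast
  ultimately show ?thesis by fastforce
qed

lemma vector_fields_tangent: "X \<in> vector_fields A \<Longrightarrow> X x \<in> tangent_space A x"
  unfolding vector_fields_def by blast

lemma linear_connection_vector_field:
  "linear_connection A D \<Longrightarrow> Z \<in> vector_fields A \<Longrightarrow> X \<in> vector_fields A \<Longrightarrow> D Z X \<in> vector_fields A"
  unfolding linear_connection_def by blast

lemma tensor_field_11_vector_field:
  "tensor_field_11 A K \<Longrightarrow> X \<in> vector_fields A \<Longrightarrow> endo_apply K X \<in> vector_fields A"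
  unfolding tensor_field_11_def by blast

lemma endo_covariant_derivative_tangent:
  assumes "linear_connection A D" "tensor_field_11 A K" "Z \<in> vector_fields A" "X \<in> vector_fields A"
  shows "endo_covariant_derivative D K Z X x \<in> tangent_space A x"
  unfolding endo_covariant_derivative_def
  using assms linear_connection_vector_field tensor_field_11_vector_field
  by (metis tangent_space_tv_diff vector_fields_tangent)

text \<open>
  Compute the derivative along \<open>Z\<close> of the function \<open>g(K X, Y) = g(X, K' Y)\<close> in both ways.  The terms
  \<open>g(K X, D\<^sup>*\<^sub>Z Y)\<close> and \<open>g(D\<^sub>Z X, K' Y)\<close> are moved across by adjointness, which is available because
  the covariant derivatives are vector fields again.
\<close>

lemma endo_covariant_derivative_adjoint:
  assumes g: "pseudo_riemannian_metric A g"
    and D: "linear_connection A D" and Dstar: "conjugate_connection A g D Dstar"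
    and K: "tensor_field_11 A K" "tensor_field_11 A K'"
    and adjoint: "\<And>X Y. X \<in> vector_fields A \<Longrightarrow> Y \<in> vector_fields A
      \<Longrightarrow> metric_apply g (endo_apply K X) Y = metric_apply g X (endo_apply K' Y)"
    and XYZ: "X \<in> vector_fields A" "Y \<in> vector_fields A" "Z \<in> vector_fields A"
  shows "g x (endo_covariant_derivative D K Z X x) (Y x) = g x (X x) (endo_covariant_derivative Dstar K' Z Y x)"
proof -
  have Dstar': "linear_connection A Dstar"
    using Dstar unfolding conjugate_connection_def by blast
  have conj: "Z x (metric_apply g X Y) = g x (D Z X x) (Y x) + g x (X x) (Dstar Z Y x)"
    if "X \<in> vector_fields A" "Y \<in> vector_fields A" for X Y
    using Dstar that XYZ(3) unfolding conjugate_connection_def metric_apply_def by blast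
  have adj: "g x (endo_apply K X x) (Y x) = g x (X x) (endo_apply K' Y x)"
    if "X \<in> vector_fields A" "Y \<in> vector_fields A" for X Y
    using adjoint[OF that] unfolding metric_apply_def by metis
  note VF = linear_connection_vector_field[OF D XYZ(3)] linear_connection_vector_field[OF Dstar' XYZ(3)]
    tensor_field_11_vector_field[OF K(1)] tensor_field_11_vector_field[OF K(2)] XYZ
  have "g x (D Z (endo_apply K X) x) (Y x) + g x (endo_apply K X x) (Dstar Z Y x)
      = Z x (metric_apply g (endo_apply K X) Y)"
    by (intro conj[symmetric] VF)
  also have "\<dots> = Z x (metric_apply g X (endo_apply K' Y))"
    using adjoint[OF XYZ(1,2)] by metis
  also have "\<dots> = g x (D Z X x) (endo_apply K' Y x) + g x (X x) (Dstar Z (endo_apply K' Y) x)"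
    by (intro conj VF)
  finally have "g x (D Z (endo_apply K X) x) (Y x) - g x (endo_apply K (D Z X) x) (Y x)
      = g x (X x) (Dstar Z (endo_apply K' Y) x) - g x (X x) (endo_apply K' (Dstar Z Y) x)"
    using adj[of X "Dstar Z Y"] adj[of "D Z X" Y] VF by simp
  moreover have "g x (endo_covariant_derivative D K Z X x) (Y x)
      = g x (D Z (endo_apply K X) x) (Y x) - g x (endo_apply K (D Z X) x) (Y x)"
    unfolding endo_covariant_derivative_def
    by (intro metric_tv_diff_left[OF g] vector_fields_tangent VF)
  moreover have "g x (X x) (endo_covariant_derivative Dstar K' Z Y x)
      = g x (X x) (Dstar Z (endo_apply K' Y) x) - g x (X x) (endo_apply K' (Dstar Z Y) x)"
  proof -
    have flip: "g x (X x) (W x) = g x (W x) (X x)" if "W \<in> vector_fields A" for W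
      by (intro metric_symmetric[OF g] vector_fields_tangent that XYZ)
    have "g x (X x) (endo_covariant_derivative Dstar K' Z Y x) = g x (endo_covariant_derivative Dstar K' Z Y x) (X x)"
      by (intro metric_symmetric[OF g] endo_covariant_derivative_tangent[OF Dstar' K(2)] vector_fields_tangent XYZ)
    also have "\<dots> = g x (Dstar Z (endo_apply K' Y) x) (X x) - g x (endo_apply K' (Dstar Z Y) x) (X x)"
      unfolding endo_covariant_derivative_def
      by (intro metric_tv_diff_left[OF g] vector_fields_tangent VF)
    finally show ?thesis
      using flip[of "Dstar Z (endo_apply K' Y)"] flip[of "endo_apply K' (Dstar Z Y)"] VF by simp
  qed
  ultimately show ?thesis by simp
qed

lemma K_connection_iff_conjugate_adjoint_connection:
  fixes A :: "('a::t2_space, 'b::euclidean_space) chart set"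
  assumes A: "smooth_atlas A" and g: "pseudo_riemannian_metric A g"
    and D: "linear_connection A D" and Dstar: "conjugate_connection A g D Dstar"
    and K: "tensor_field_11 A K" "tensor_field_11 A K'"
    and adjoint: "\<And>X Y. X \<in> vector_fields A \<Longrightarrow> Y \<in> vector_fields A
      \<Longrightarrow> metric_apply g (endo_apply K X) Y = metric_apply g X (endo_apply K' Y)"
  shows "is_K_connection A K D \<longleftrightarrow> is_K_connection A K' Dstar"
proof -
  have Dstar': "linear_connection A Dstar"
    using Dstar unfolding conjugate_connection_def by blast
  note T = endo_covariant_derivative_tangent[OF D K(1)] endo_covariant_derivative_tangent[OF Dstar' K(2)]
  have adj: "g x (endo_covariant_derivative D K Z X x) (Y x) = g x (X x) (endo_covariant_derivative Dstar K' Z Y x)"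
    if "X \<in> vector_fields A" "Y \<in> vector_fields A" "Z \<in> vector_fields A" for X Y Z x
    using g D Dstar K adjoint that by (rule endo_covariant_derivative_adjoint)
  have zero: "g x tv_zero v = 0" "g x v tv_zero = 0" if "v \<in> tangent_space A x" for x v
  proof -
    have "tv_diff v v = tv_zero"
      by (simp add: tv_diff_def tv_zero_def)
    then show "g x tv_zero v = 0"
      using metric_tv_diff_left[OF g that that that] by simp
    moreover have "tv_zero \<in> tangent_space A x"
      using tangent_space_tv_diff[OF that that] \<open>tv_diff v v = tv_zero\<close> by simp
    ultimately show "g x v tv_zero = 0"
      using metric_symmetric[OF g that] by simp
  qed
  show ?thesis
  proof
    assume *: "is_K_connection A K D"
    show "is_K_connection A K' Dstar"
      unfolding is_K_connection_def
    proof (intro ballI allI)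
      fix Z Y x assume ZY: "Z \<in> vector_fields A" "Y \<in> vector_fields A"
      show "endo_covariant_derivative Dstar K' Z Y x = tv_zero"
      proof (rule metric_nondegenerate_on_vector_fields[OF A g T(2)[OF ZY]])
        fix X assume X: "X \<in> vector_fields A"
        have "g x (X x) (endo_covariant_derivative Dstar K' Z Y x) = 0"
          using adj[OF X ZY(2,1), of x] * X ZY zero(1)[OF vector_fields_tangent]
          unfolding is_K_connection_def by simp
        then show "g x (endo_covariant_derivative Dstar K' Z Y x) (X x) = 0"
          using metric_symmetric[OF g T(2)[OF ZY] vector_fields_tangent[OF X]] by simp
      qed
    qed
  next
    assume *: "is_K_connection A K' Dstar"
    show "is_K_connection A K D"
      unfolding is_K_connection_def
    proof (intro ballI allI)
      fix Z X x assume ZX: "Z \<in> vector_fields A" "X \<in> vector_fields A"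
      show "endo_covariant_derivative D K Z X x = tv_zero"
      proof (rule metric_nondegenerate_on_vector_fields[OF A g T(1)[OF ZX]])
        fix Y assume Y: "Y \<in> vector_fields A"
        show "g x (endo_covariant_derivative D K Z X x) (Y x) = 0"
          using adj[OF ZX(2) Y ZX(1), of x] * Y ZX zero(2)[OF vector_fields_tangent]
          unfolding is_K_connection_def by simp
      qed
    qed
  qed
qed

theorem proposition22:
  fixes A :: "('a::{t2_space,second_countable_topology}, 'b::euclidean_space) chart set"
    and J Jstar :: "'a endo_field"
    and g :: "'a metric_field"
    and D Dstar :: "'a connection"
  assumes "metallic_like_pseudo_riemannian A J g Jstar"
    and "linear_connection A D"
    and "conjugate_connection A g D Dstar"
  shows "(is_K_connection A Jstar D \<longleftrightarrow> is_K_connection A J Dstar) \<and>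
         (is_K_connection A J D \<longleftrightarrow> is_K_connection A Jstar Dstar)"
proof -
  from assms(1) have A: "smooth_atlas A" and g: "pseudo_riemannian_metric A g"
    and J: "tensor_field_11 A J" "tensor_field_11 A Jstar"
    and adjoint: "\<And>X Y. X \<in> vector_fields A \<Longrightarrow> Y \<in> vector_fields A
      \<Longrightarrow> metric_apply g (endo_apply J X) Y = metric_apply g X (endo_apply Jstar Y)"
    unfolding metallic_like_pseudo_riemannian_def metallic_structure_def bundle_isomorphism_def by blast+
  have sym: "metric_apply g X Y = metric_apply g Y X"
    if "X \<in> vector_fields A" "Y \<in> vector_fields A" for X Y
    unfolding metric_apply_def
    by (intro ext metric_symmetric[OF g] vector_fields_tangent that)
  have adjoint': "metric_apply g (endo_apply Jstar X) Y = metric_apply g X (endo_apply J Y)"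
    if "X \<in> vector_fields A" "Y \<in> vector_fields A" for X Y
    using adjoint[OF that(2,1)] sym[OF that(1) tensor_field_11_vector_field[OF J(1) that(2)]]
      sym[OF tensor_field_11_vector_field[OF J(2) that(1)] that(2)] by simp
  show ?thesis
  proof
    show "is_K_connection A Jstar D \<longleftrightarrow> is_K_connection A J Dstar"
      using A g assms(2,3) J(2,1) adjoint' by (rule K_connection_iff_conjugate_adjoint_connection)
    show "is_K_connection A J D \<longleftrightarrow> is_K_connection A Jstar Dstar"
      using A g assms(2,3) J adjoint by (rule K_connection_iff_conjugate_adjoint_connection)
  qed
qed

end
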